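(* Let $a,c,y\in\mathbb{R}$ satisfy $c<0<a$, $2c+a<0$, $c<-a-c<a$ and $y\in[c,-a-c]$, and let $x_0$, $w_1$, $w_2$ be the functions defined in the context from $a,c,y$. Let $\{B(t)\}_{t\ge0}$ be a one-dimensional standard Brownian motion on a complete probability space $(\Omega,\mathcal{F},\mathbb{P})$ with Brownian filtration $\{\mathcal{F}^B_t\}_{t\ge 0}$, let $x_1$ be the process defined in the context, and, inductively for $n\ge2$, consider the random differential equation $$\ddot x_n(t)=2x_0(t)x_n(t)+\sum_{j=1}^{n-1}x_j(t)x_{n-j}(t),\qquad x_n(0)=0,\quad\dot x_n(0)=0,$$ where $x_1,\dots,x_{n-1}$ are the solutions at the previous steps. Then for every $n\ge2$ this equation has a unique global (i.e. defined for all $t\ge 0$) strong solution adapted to $\{\mathcal{F}^B_t\}_{t\ge0}$. The solution can be represented as $$x_n(t)=w_2(t)\int_0^t w_1(s)\Big(\sum_{j=1}^{n-1}x_j(s)x_{n-j}(s)\Big)ds-w_1(t)\int_0^t w_2(s)\Big(\sum_{j=1}^{n-1}x_j(s)x_{n-j}(s)\Big)ds,$$ or equivalently $$x_n(t)=\int_0^t\mathcal{K}(t,s)\Big(\sum_{j=1}^{n-1}x_j(s)x_{n-j}(s)\Big)ds,\qquad \mathcal{K}(t,s):=w_2(t)w_1(s)-w_1(t)w_2(s).$$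
   Context: The process $x_1$ is the unique strong solution of $\ddot x_1(t)=2x_0(t)x_1(t)+\dot B(t)$, $x_1(0)=\dot x_1(0)=0$ (i.e. $dx_1=\xi_1dt$, $d\xi_1=2x_0x_1dt+dB$, zero initial data), namely $x_1(t)=\int_0^t\mathcal{K}(t,s)\,dB(s)=w_2(t)\int_0^tw_1(s)\,dB(s)-w_1(t)\int_0^tw_2(s)\,dB(s)$. The equation for $x_n$ is understood as the first order system $\dot x_n=\xi_n$, $\dot\xi_n=2x_0x_n+\sum_{j=1}^{n-1}x_jx_{n-j}$, $x_n(0)=\xi_n(0)=0$, with random coefficients. Let $q:=\sqrt{\frac{2c+a}{c-a}}\in(0,1)$, $F(\gamma,q):=\int_0^\gamma\frac{d\alpha}{\sqrt{1-q^2\sin^2\alpha}}$, $i_y:=F\big(\arcsin\sqrt{\frac{c-y}{2c+a}},q\big)$, and let $\mathrm{sn},\mathrm{cn},\mathrm{dn}$ be the Jacobi elliptic functions (second argument = modulus $q$). Set $$x_0(t):=c-(a+2c)\,\mathrm{sn}^2\Big(\sqrt{\tfrac{a-c}{6}}\,t+i_y,q\Big).$$ Let $\mathcal{E}(t,q):=\int_0^t\mathrm{dn}^2(s,q)\,ds$ (Jacobi's Epsilon function) and $$u_1(t):=\mathrm{sn}(t,q)\,\mathrm{cn}(t,q)\,\mathrm{dn}(t,q),$$ $$u_2(t):=\alpha_0+\alpha_1\mathrm{cn}^2(t,q)+\alpha_2\mathrm{cn}^4(t,q)+\big(\beta_0t+\beta_1\mathcal{E}(t,q)\big)u_1(t),$$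 with $\alpha_0=-1+q^2$, $\alpha_1=-2q^6+3q^4-5q^2+2$, $\alpha_2=2q^2(q^4-q^2+1)$, $\beta_0=-q^4+3q^2-2$, $\beta_1=2(q^4-q^2+1)$. The functions $w_i(t):=\kappa_i\,u_i\big(\sqrt{\tfrac{a-c}{6}}\,t+i_y\big)$, $i=1,2$, where $\kappa_1,\kappa_2$ are fixed nonzero real constants chosen so that the Wronskian is normalized, $w_1\dot w_2-\dot w_1w_2=1$, are two linearly independent solutions of $\ddot w(t)-2x_0(t)w(t)=0$. *)

theory Defs
  imports "HOL-Probability.Probability"
begin

section \<open>Jacobi elliptic functions\<close>

text \<open>Throughout, the second argument \<open>q\<close> is the modulus (not the parameter \<open>q\<^sup>2\<close>). The interval
  integrals are oriented, so the functions below are defined on the whole real line.\<close>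

definition ellF :: "real \<Rightarrow> real \<Rightarrow> real" where
  "ellF \<gamma> q = (LBINT \<alpha>=0..\<gamma>. 1 / sqrt (1 - q\<^sup>2 * (sin \<alpha>)\<^sup>2))"

text \<open>For \<open>0 \<le> q < 1\<close> the map \<open>\<gamma> \<mapsto> ellF \<gamma> q\<close> is an increasing bijection of the reals; its inverse
  is the Jacobi amplitude.\<close>

definition jacobi_am :: "real \<Rightarrow> real \<Rightarrow> real" where
  "jacobi_am t q = inv (\<lambda>\<gamma>. ellF \<gamma> q) t"

definition sn :: "real \<Rightarrow> real \<Rightarrow> real" where
  "sn t q = sin (jacobi_am t q)"

definition cn :: "real \<Rightarrow> real \<Rightarrow> real" where
  "cn t q = cos (jacobi_am t q)"

definition dn :: "real \<Rightarrow> real \<Rightarrow> real" where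
  "dn t q = sqrt (1 - q\<^sup>2 * (sn t q)\<^sup>2)"

definition jacobi_Eps :: "real \<Rightarrow> real \<Rightarrow> real" where
  "jacobi_Eps t q = (LBINT s=0..t. (dn s q)\<^sup>2)"

section \<open>The deterministic functions \<open>x\<^sub>0\<close>, \<open>w\<^sub>1\<close>, \<open>w\<^sub>2\<close>\<close>

definition ell_modulus :: "real \<Rightarrow> real \<Rightarrow> real" where
  "ell_modulus a c = sqrt ((2 * c + a) / (c - a))"

definition ell_shift :: "real \<Rightarrow> real \<Rightarrow> real \<Rightarrow> real" where
  "ell_shift a c y = ellF (arcsin (sqrt ((c - y) / (2 * c + a)))) (ell_modulus a c)"

definition ell_arg :: "real \<Rightarrow> real \<Rightarrow> real \<Rightarrow> real \<Rightarrow> real" where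
  "ell_arg a c y t = sqrt ((a - c) / 6) * t + ell_shift a c y"

definition x0 :: "real \<Rightarrow> real \<Rightarrow> real \<Rightarrow> real \<Rightarrow> real" where
  "x0 a c y t = c - (a + 2 * c) * (sn (ell_arg a c y t) (ell_modulus a c))\<^sup>2"

definition u1 :: "real \<Rightarrow> real \<Rightarrow> real" where
  "u1 q t = sn t q * cn t q * dn t q"

definition u2 :: "real \<Rightarrow> real \<Rightarrow> real" where
  "u2 q t =
    (let \<alpha>0 = - 1 + q^2;
         \<alpha>1 = - 2 * q^6 + 3 * q^4 - 5 * q^2 + 2;
         \<alpha>2 = 2 * q^2 * (q^4 - q^2 + 1);
         \<beta>0 = - (q^4) + 3 * q^2 - 2;
         \<beta>1 = 2 * (q^4 - q^2 + 1)
     in \<alpha>0 + \<alpha>1 * (cn t q)^2 + \<alpha>2 * (cn t q)^4 + (\<beta>0 * t + \<beta>1 * jacobi_Eps t q) * u1 q t)"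

definition w1 :: "real \<Rightarrow> real \<Rightarrow> real \<Rightarrow> real \<Rightarrow> real \<Rightarrow> real" where
  "w1 \<kappa>1 a c y t = \<kappa>1 * u1 (ell_modulus a c) (ell_arg a c y t)"

definition w2 :: "real \<Rightarrow> real \<Rightarrow> real \<Rightarrow> real \<Rightarrow> real \<Rightarrow> real" where
  "w2 \<kappa>2 a c y t = \<kappa>2 * u2 (ell_modulus a c) (ell_arg a c y t)"

definition volterra_kernel :: "(real \<Rightarrow> real) \<Rightarrow> (real \<Rightarrow> real) \<Rightarrow> real \<Rightarrow> real \<Rightarrow> real" where
  "volterra_kernel f g t s = g t * f s - f t * g s"

section \<open>Brownian motion\<close>

text \<open>Processes are functions of a real time, of which only the values at times \<open>t \<ge> 0\<close> matter.\<close>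

definition brownian_motion :: "'w measure \<Rightarrow> (real \<Rightarrow> 'w \<Rightarrow> real) \<Rightarrow> bool" where
  "brownian_motion M B \<longleftrightarrow>
     prob_space M \<and>
     (\<forall>t\<ge>0. B t \<in> borel_measurable M) \<and>
     (AE \<omega> in M. B 0 \<omega> = 0) \<and>
     (\<forall>(k::nat) \<tau>. 0 \<le> \<tau> 0 \<and> (\<forall>i<k. \<tau> i \<le> \<tau> (Suc i)) \<longrightarrow>
        prob_space.indep_vars M (\<lambda>_. borel) (\<lambda>i \<omega>. B (\<tau> (Suc i)) \<omega> - B (\<tau> i) \<omega>) {..<k}) \<and>
     (\<forall>s t. 0 \<le> s \<and> s < t \<longrightarrow>
        distributed M lborel (\<lambda>\<omega>. B t \<omega> - B s \<omega>) (normal_density 0 (sqrt (t - s)))) \<and>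
     (AE \<omega> in M. continuous_on {0..} (\<lambda>t. B t \<omega>))"

text \<open>The Brownian filtration is the natural filtration augmented by the null sets.\<close>

definition brownian_filtration :: "'w measure \<Rightarrow> (real \<Rightarrow> 'w \<Rightarrow> real) \<Rightarrow> real \<Rightarrow> 'w measure" where
  "brownian_filtration M B t =
     sigma (space M)
       ({B s -` A \<inter> space M | s A. 0 \<le> s \<and> s \<le> t \<and> A \<in> sets borel} \<union> null_sets M)"

definition adapted :: "(real \<Rightarrow> 'w measure) \<Rightarrow> (real \<Rightarrow> 'w \<Rightarrow> real) \<Rightarrow> bool" where
  "adapted F X \<longleftrightarrow> (\<forall>t\<ge>0. X t \<in> borel_measurable (F t))"

section \<open>Strong solutions\<close>

text \<open>Global strong solution \<open>(X, \<Xi>)\<close> of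
  \<open>dX = \<Xi> dt\<close>, \<open>d\<Xi> = 2 v X dt + dB\<close> with zero initial data, in integrated form; since the
  noise is additive with constant coefficient, its stochastic integral is \<open>B t - B 0\<close>.\<close>

definition strong_solution_sde ::
  "'w measure \<Rightarrow> (real \<Rightarrow> 'w \<Rightarrow> real) \<Rightarrow> (real \<Rightarrow> real) \<Rightarrow>
   (real \<Rightarrow> 'w \<Rightarrow> real) \<Rightarrow> (real \<Rightarrow> 'w \<Rightarrow> real) \<Rightarrow> bool" where
  "strong_solution_sde M B v X \<Xi> \<longleftrightarrow>
     adapted (brownian_filtration M B) X \<and>
     adapted (brownian_filtration M B) \<Xi> \<and>
     (AE \<omega> in M.
        continuous_on {0..} (\<lambda>t. X t \<omega>) \<and>
        continuous_on {0..} (\<lambda>t. \<Xi> t \<omega>) \<and>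
        (\<forall>t\<ge>0. X t \<omega> = integral {0..t} (\<lambda>s. \<Xi> s \<omega>)) \<and>
        (\<forall>t\<ge>0. \<Xi> t \<omega> = integral {0..t} (\<lambda>s. 2 * v s * X s \<omega>) + (B t \<omega> - B 0 \<omega>)))"

text \<open>Global strong solution \<open>(X, \<Xi>)\<close> of the random first order system
  \<open>X' = \<Xi>\<close>, \<open>\<Xi>' = 2 v X + f\<close> with zero initial data, adapted to the Brownian filtration.\<close>

definition strong_solution_rode ::
  "'w measure \<Rightarrow> (real \<Rightarrow> 'w \<Rightarrow> real) \<Rightarrow> (real \<Rightarrow> real) \<Rightarrow> (real \<Rightarrow> 'w \<Rightarrow> real) \<Rightarrow>
   (real \<Rightarrow> 'w \<Rightarrow> real) \<Rightarrow> (real \<Rightarrow> 'w \<Rightarrow> real) \<Rightarrow> bool" where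
  "strong_solution_rode M B v f X \<Xi> \<longleftrightarrow>
     adapted (brownian_filtration M B) X \<and>
     adapted (brownian_filtration M B) \<Xi> \<and>
     (AE \<omega> in M.
        X 0 \<omega> = 0 \<and> \<Xi> 0 \<omega> = 0 \<and>
        (\<forall>t\<ge>0. ((\<lambda>s. X s \<omega>) has_real_derivative \<Xi> t \<omega>) (at t within {0..})) \<and>
        (\<forall>t\<ge>0. ((\<lambda>s. \<Xi> s \<omega>) has_real_derivative (2 * v t * X t \<omega> + f t \<omega>)) (at t within {0..})))"

definition forcing :: "(nat \<Rightarrow> real \<Rightarrow> 'w \<Rightarrow> real) \<Rightarrow> nat \<Rightarrow> real \<Rightarrow> 'w \<Rightarrow> real" where
  "forcing x n t \<omega> = (\<Sum>j=1..n-1. x j t \<omega> * x (n - j) t \<omega>)"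

definition indistinguishable ::
  "'w measure \<Rightarrow> (real \<Rightarrow> 'w \<Rightarrow> real) \<Rightarrow> (real \<Rightarrow> 'w \<Rightarrow> real) \<Rightarrow> bool" where
  "indistinguishable M X Y \<longleftrightarrow> (AE \<omega> in M. \<forall>t\<ge>0. X t \<omega> = Y t \<omega>)"

end

theory Submission
  imports Defs
begin

text \<open>
  The equation for \<open>x\<^sub>n\<close> is linear in \<open>x\<^sub>n\<close>, with the deterministic potential \<open>2 x\<^sub>0\<close> and a forcing
  \<open>f\<close> that depends only on \<open>x\<^sub>1, \<dots>, x\<^sub>n\<^sub>-\<^sub>1\<close>; it can therefore be solved path by path by variation of
  constants, and the only probabilistic issue is adaptedness.

  The homogeneous equation comes first. For a modulus \<open>q\<close> with \<open>q\<^sup>2 < 1\<close> the elliptic integral is a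
  diffeomorphism of the line, so its inverse, the amplitude, has derivative \<open>dn\<close>, and the usual
  differentiation rules for \<open>sn\<close>, \<open>cn\<close>, \<open>dn\<close> follow. They show that both \<open>u\<^sub>1\<close> and \<open>u\<^sub>2\<close> solve the
  Lame equation \<open>u'' = (12 q\<^sup>2 sn\<^sup>2 - 4 (1 + q\<^sup>2)) u\<close> (\<open>u1'_deriv\<close>, \<open>u2'_deriv\<close>), and an affine change
  of time carries this equation into \<open>w'' = 2 x\<^sub>0 w\<close> (\<open>rescaled_Lame_solution\<close>).

  Let \<open>\<phi>, \<psi>\<close> be solutions of \<open>w'' = 2 v w\<close> with \<open>\<phi> \<psi>' - \<phi>' \<psi> = 1\<close>. For a path \<open>(X, \<Xi>)\<close> of the
  forced system with zero initial data, \<open>\<phi> \<Xi> - \<phi>' X\<close> and \<open>\<psi> \<Xi> - \<psi>' X\<close> have the derivatives \<open>\<phi> f\<close>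
  and \<open>\<psi> f\<close>. Inverting this \<open>2\<close> by \<open>2\<close> linear system, whose determinant is the Wronskian, expresses
  \<open>X\<close> and \<open>\<Xi>\<close> through the integrals of \<open>\<phi> f\<close> and \<open>\<psi> f\<close> (\<open>solution_representation\<close>). This gives the
  formula and uniqueness together. Conversely, if \<open>f\<close> is continuous then the formula defines a
  solution (\<open>solution_exists\<close>).

  The paths of \<open>x\<^sub>1, \<dots>, x\<^sub>n\<^sub>-\<^sub>1\<close>, and hence those of \<open>f\<close>, are almost surely continuous. Almost surely
  the integrals are thus limits of Riemann sums of values at times at most \<open>t\<close>; since the Brownian
  filtration contains all null sets of a complete space, they are adapted (\<open>integral_adapted\<close>), and
  so is the solution.
\<close>


section \<open>Derivatives of the Jacobi elliptic functions\<close>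

lemma LBINT_has_real_derivative:
  fixes f :: "real \<Rightarrow> real"
  assumes "continuous_on UNIV f"
  shows "((\<lambda>u. LBINT y=0..u. f y) has_real_derivative f x) (at x)"
proof -
  have "((\<lambda>u. LBINT y=ereal 0..ereal u. f y) has_vector_derivative f x)
          (at x within {-\<bar>x\<bar>-1..\<bar>x\<bar>+1})"
    by (intro interval_integral_FTC2 continuous_on_subset[OF assms]) auto
  moreover have "at x within {-\<bar>x\<bar>-1..\<bar>x\<bar>+1} = at x"
    by (rule at_within_Icc_at) auto
  ultimately show ?thesis
    by (simp add: zero_ereal_def has_real_derivative_iff_has_vector_derivative)
qed

lemma ell_integrand_pos:
  fixes q :: real
  assumes "q\<^sup>2 < 1"
  shows "0 < 1 - q\<^sup>2 * (sin \<alpha>)\<^sup>2"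
proof -
  have "q\<^sup>2 * (sin \<alpha>)\<^sup>2 \<le> q\<^sup>2 * 1"
    by (intro mult_left_mono) (auto simp: abs_square_le_1)
  with assms show ?thesis by linarith
qed

lemma ellF_deriv:
  assumes "q\<^sup>2 < 1"
  shows "((\<lambda>\<gamma>. ellF \<gamma> q) has_real_derivative 1 / sqrt (1 - q\<^sup>2 * (sin \<gamma>)\<^sup>2)) (at \<gamma>)"
  unfolding ellF_def
  using ell_integrand_pos[OF assms]
  by (intro LBINT_has_real_derivative continuous_intros) (auto simp: less_imp_neq[symmetric])

text \<open>The integrand of \<open>ellF\<close> is at least \<open>1\<close>, so \<open>ellF\<close> grows at least as fast as the
  identity; this gives both injectivity and unboundedness in each direction.\<close>

lemma ellF_expanding:
  assumes "q\<^sup>2 < 1" "\<gamma> \<le> \<delta>"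
  shows "\<delta> - \<gamma> \<le> ellF \<delta> q - ellF \<gamma> q"
proof -
  have "ellF \<gamma> q - \<gamma> \<le> ellF \<delta> q - \<delta>"
  proof (rule DERIV_nonneg_imp_nondecreasing[OF \<open>\<gamma> \<le> \<delta>\<close>])
    fix x
    have "((\<lambda>\<gamma>. ellF \<gamma> q - \<gamma>) has_real_derivative 1 / sqrt (1 - q\<^sup>2 * (sin x)\<^sup>2) - 1) (at x)"
      by (intro derivative_intros ellF_deriv assms)
    moreover have "1 / sqrt (1 - q\<^sup>2 * (sin x)\<^sup>2) \<ge> 1"
      using ell_integrand_pos[OF assms(1), of x] by (simp add: real_sqrt_le_1_iff)
    ultimately show "\<exists>y. ((\<lambda>\<gamma>. ellF \<gamma> q - \<gamma>) has_real_derivative y) (at x) \<and> y \<ge> 0"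
      by (metis diff_ge_0_iff_ge)
  qed
  then show ?thesis by linarith
qed

lemma bij_ellF:
  assumes "q\<^sup>2 < 1"
  shows "bij (\<lambda>\<gamma>. ellF \<gamma> q)"
proof (rule bijI)
  show "inj (\<lambda>\<gamma>. ellF \<gamma> q)"
  proof (rule injI)
    fix x y assume "ellF x q = ellF y q"
    then show "x = y"
      using ellF_expanding[OF assms, of x y] ellF_expanding[OF assms, of y x] by linarith
  qed
  show "surj (\<lambda>\<gamma>. ellF \<gamma> q)"
  proof (rule surjI)
    fix t :: real
    have "ellF 0 q = 0" by (simp add: ellF_def zero_ereal_def[symmetric])
    then have "ellF (- \<bar>t\<bar>) q \<le> t" "t \<le> ellF \<bar>t\<bar> q"
      using ellF_expanding[OF assms, of "-\<bar>t\<bar>" 0] ellF_expanding[OF assms, of 0 "\<bar>t\<bar>"] by linarith+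
    moreover have "isCont (\<lambda>\<gamma>. ellF \<gamma> q) x" for x
      using ellF_deriv[OF assms] DERIV_isCont by blast
    ultimately have "\<exists>\<gamma>. ellF \<gamma> q = t"
      using IVT[of "\<lambda>\<gamma>. ellF \<gamma> q" "- \<bar>t\<bar>" t "\<bar>t\<bar>"] by fastforce
    then show "ellF (SOME \<gamma>. ellF \<gamma> q = t) q = t" by (rule someI_ex)
  qed
qed

lemma dn_pos:
  assumes "q\<^sup>2 < 1"
  shows "0 < dn t q"
  using ell_integrand_pos[OF assms] by (simp add: dn_def sn_def)

lemma dn_squared:
  assumes "q\<^sup>2 < 1"
  shows "(dn t q)\<^sup>2 = 1 - q\<^sup>2 * (sn t q)\<^sup>2"
  using ell_integrand_pos[OF assms] by (simp add: dn_def sn_def less_imp_le)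

lemma jacobi_am_deriv:
  assumes "q\<^sup>2 < 1"
  shows "((\<lambda>t. jacobi_am t q) has_real_derivative dn t q) (at t)"
proof -
  let ?F = "\<lambda>\<gamma>. ellF \<gamma> q" and ?D = "\<lambda>\<gamma>. 1 / sqrt (1 - q\<^sup>2 * (sin \<gamma>)\<^sup>2)"
  have cont: "continuous_on UNIV ?F"
    using ellF_deriv[OF assms] DERIV_isCont by (blast intro: continuous_at_imp_continuous_on)
  have "?F (jacobi_am t q) = t"
    unfolding jacobi_am_def by (rule surj_f_inv_f[OF bij_is_surj[OF bij_ellF[OF assms]]])
  moreover have "((\<lambda>t. jacobi_am t q) has_derivative (*) (inverse (?D \<gamma>))) (at (?F \<gamma>))" for \<gamma>
  proof (rule has_derivative_inverse_strong[where f = ?F and f' = "(*) (?D \<gamma>)" and S = UNIV])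
    show "jacobi_am (?F x) q = x" for x
      unfolding jacobi_am_def by (rule inv_f_f[OF bij_is_inj[OF bij_ellF[OF assms]]])
    show "(?F has_derivative (*) (?D \<gamma>)) (at \<gamma>)"
      using ellF_deriv[OF assms] by (simp add: has_field_derivative_def)
    show "(*) (?D \<gamma>) \<circ> (*) (inverse (?D \<gamma>)) = id"
      using ell_integrand_pos[OF assms, of \<gamma>] by (auto simp: fun_eq_iff)
  qed (use cont in auto)
  ultimately show ?thesis
    unfolding has_field_derivative_def dn_def sn_def
    by (metis inverse_eq_divide inverse_inverse_eq)
qed

lemma sn_deriv:
  assumes "q\<^sup>2 < 1"
  shows "((\<lambda>t. sn t q) has_real_derivative cn t q * dn t q) (at t)"
  unfolding sn_def cn_def
  by (auto intro!: derivative_eq_intros jacobi_am_deriv[OF assms])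

lemma cn_deriv:
  assumes "q\<^sup>2 < 1"
  shows "((\<lambda>t. cn t q) has_real_derivative - (sn t q * dn t q)) (at t)"
  unfolding sn_def cn_def
  by (auto intro!: derivative_eq_intros jacobi_am_deriv[OF assms])

lemma dn_deriv:
  assumes "q\<^sup>2 < 1"
  shows "((\<lambda>t. dn t q) has_real_derivative - (q\<^sup>2 * sn t q * cn t q)) (at t)"
proof -
  have "0 < 1 - q\<^sup>2 * (sn t q)\<^sup>2"
    using ell_integrand_pos[OF assms] by (simp add: sn_def)
  then have "((\<lambda>t. sqrt (1 - q\<^sup>2 * (sn t q)\<^sup>2)) has_real_derivative
          inverse (dn t q) / 2 * - (q\<^sup>2 * (2 * sn t q * (cn t q * dn t q)))) (at t)"
    unfolding dn_def by (auto intro!: derivative_eq_intros sn_deriv[OF assms] simp: dn_def)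
  then show ?thesis
    using dn_pos[OF assms, of t] by (simp add: dn_def[abs_def] field_simps)
qed

lemma jacobi_Eps_deriv:
  assumes "q\<^sup>2 < 1"
  shows "((\<lambda>t. jacobi_Eps t q) has_real_derivative (dn t q)\<^sup>2) (at t)"
proof -
  have "continuous_on UNIV (\<lambda>t. dn t q)"
    using dn_deriv[OF assms] DERIV_isCont by (blast intro: continuous_at_imp_continuous_on)
  then show ?thesis
    unfolding jacobi_Eps_def by (intro LBINT_has_real_derivative continuous_intros)
qed

section \<open>The Lame equation\<close>

text \<open>With \<open>S = (sn t q)\<^sup>2\<close> one has \<open>u\<^sub>1 = S' / 2\<close>, so the Jacobi identities turn
  \<open>u\<^sub>1'\<close> into a quadratic polynomial in \<open>S\<close>.\<close>

definition u1' :: "real \<Rightarrow> real \<Rightarrow> real" where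
  "u1' q t = 1 - 2 * (1 + q\<^sup>2) * (sn t q)\<^sup>2 + 3 * q\<^sup>2 * (sn t q)^4"

lemma cn_squared: "(cn t q)\<^sup>2 = 1 - (sn t q)\<^sup>2"
  by (simp add: cn_def sn_def cos_squared_eq)

lemma u1_deriv:
  assumes "q\<^sup>2 < 1"
  shows "(u1 q has_real_derivative u1' q t) (at t)"
proof -
  let ?s = "sn t q" and ?c = "cn t q" and ?d = "dn t q"
  have "(u1 q has_real_derivative
          (?s * ?c) * - (q\<^sup>2 * ?s * ?c) + (?s * - (?s * ?d) + (?c * ?d) * ?c) * ?d) (at t)"
    unfolding u1_def[abs_def]
    by (auto intro!: derivative_eq_intros sn_deriv cn_deriv dn_deriv assms)
  moreover have "(?s * ?c) * - (q\<^sup>2 * ?s * ?c) + (?s * - (?s * ?d) + (?c * ?d) * ?c) * ?d = u1' q t"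
    unfolding u1'_def using cn_squared[of t q] dn_squared[OF assms, of t] by algebra
  ultimately show ?thesis by simp
qed

text \<open>As \<open>u\<^sub>1'\<close> is a polynomial in \<open>S = (sn t q)\<^sup>2\<close> and \<open>S' = 2 u\<^sub>1\<close>, its derivative is \<open>u\<^sub>1\<close> times a
  polynomial in \<open>S\<close>, namely the Lame potential.\<close>

lemma u1'_deriv:
  assumes "q\<^sup>2 < 1"
  shows "(u1' q has_real_derivative (12 * q\<^sup>2 * (sn t q)\<^sup>2 - 4 * (1 + q\<^sup>2)) * u1 q t) (at t)"
  unfolding u1'_def[abs_def] u1_def
  by (auto intro!: derivative_eq_intros sn_deriv assms simp: algebra_simps power2_eq_square power3_eq_cube)

text \<open>Here \<open>- 2 u\<^sub>1\<close> is the derivative of \<open>(cn t q)\<^sup>2\<close>, so \<open>u\<^sub>1\<close> factors out of every term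
  except the one with the secular coefficient \<open>\<beta>\<^sub>0 t + \<beta>\<^sub>1 jacobi_Eps t q\<close>.\<close>

definition u2' :: "real \<Rightarrow> real \<Rightarrow> real" where
  "u2' q t =
    (let \<alpha>1 = - 2 * q^6 + 3 * q^4 - 5 * q^2 + 2;
         \<alpha>2 = 2 * q^2 * (q^4 - q^2 + 1);
         \<beta>0 = - (q^4) + 3 * q^2 - 2;
         \<beta>1 = 2 * (q^4 - q^2 + 1)
     in (- 2 * \<alpha>1 - 4 * \<alpha>2 * (cn t q)\<^sup>2 + \<beta>0 + \<beta>1 * (dn t q)\<^sup>2) * u1 q t
          + (\<beta>0 * t + \<beta>1 * jacobi_Eps t q) * u1' q t)"

lemma u2_deriv:
  assumes "q\<^sup>2 < 1"
  shows "(u2 q has_real_derivative u2' q t) (at t)"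
proof -
  have *: "((\<lambda>t. a0 + a1 * (cn t q)^2 + a2 * (cn t q)^4 + (b0 * t + b1 * jacobi_Eps t q) * u1 q t)
        has_real_derivative
          (- 2 * a1 - 4 * a2 * (cn t q)\<^sup>2 + b0 + b1 * (dn t q)\<^sup>2) * u1 q t
          + (b0 * t + b1 * jacobi_Eps t q) * u1' q t) (at t)" for a0 a1 a2 b0 b1
    by (auto intro!: derivative_eq_intros cn_deriv u1_deriv jacobi_Eps_deriv assms,
        simp add: u1_def algebra_simps power2_eq_square power3_eq_cube)
  show ?thesis
    unfolding u2_def[abs_def] u2'_def Let_def by (rule *)
qed

text \<open>The secular coefficient multiplies \<open>u\<^sub>1\<close>, which already solves the equation, so it drops out;
  what remains is an identity without \<open>t\<close> and without the Epsilon function.\<close>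

lemma u2'_deriv:
  assumes "q\<^sup>2 < 1"
  shows "(u2' q has_real_derivative (12 * q\<^sup>2 * (sn t q)\<^sup>2 - 4 * (1 + q\<^sup>2)) * u2 q t) (at t)"
proof -
  define a0 a1 a2 b0 b1 where
    ab: "a0 = - 1 + q^2" "a1 = - 2 * q^6 + 3 * q^4 - 5 * q^2 + 2"
        "a2 = 2 * q^2 * (q^4 - q^2 + 1)" "b0 = - (q^4) + 3 * q^2 - 2" "b1 = 2 * (q^4 - q^2 + 1)"
  let ?s = "sn t q" and ?c = "cn t q" and ?d = "dn t q"
  let ?V = "12 * q\<^sup>2 * ?s\<^sup>2 - 4 * (1 + q\<^sup>2)" and ?L = "b0 * t + b1 * jacobi_Eps t q"
  have u2': "u2' q = (\<lambda>t. (- 2 * a1 - 4 * a2 * (cn t q)\<^sup>2 + b0 + b1 * (dn t q)\<^sup>2) * u1 q t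
          + (b0 * t + b1 * jacobi_Eps t q) * u1' q t)"
    by (simp add: fun_eq_iff u2'_def Let_def ab)
  have u2: "u2 q t = a0 + a1 * ?c^2 + a2 * ?c^4 + ?L * u1 q t"
    by (simp add: u2_def Let_def ab)
  have deriv: "(u2' q has_real_derivative
         (8 * a2 - 2 * q\<^sup>2 * b1) * (u1 q t)\<^sup>2
         + (- 2 * a1 - 4 * a2 * ?c\<^sup>2 + 2 * b0 + 2 * b1 * ?d\<^sup>2) * u1' q t + ?L * (?V * u1 q t)) (at t)"
    unfolding u2'
    by (auto intro!: derivative_eq_intros cn_deriv dn_deriv u1_deriv u1'_deriv jacobi_Eps_deriv assms,
        simp add: u1_def algebra_simps power2_eq_square power3_eq_cube)
  \<comment> \<open>After elimination of \<open>cn\<close> and \<open>dn\<close> this is an identity between polynomials in \<open>(sn t q)\<^sup>2\<close>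
     and \<open>q\<^sup>2\<close>; the five coefficients of \<open>u2\<close> are chosen to make it hold.\<close>
  have identity: "(8 * a2 - 2 * q\<^sup>2 * b1) * (u1 q t)\<^sup>2
         + (- 2 * a1 - 4 * a2 * ?c\<^sup>2 + 2 * b0 + 2 * b1 * ?d\<^sup>2) * u1' q t
        = ?V * (a0 + a1 * ?c^2 + a2 * ?c^4)"
  proof -
    have c4: "?c ^ 4 = (?c\<^sup>2)\<^sup>2" by simp
    have u1: "(u1 q t)\<^sup>2 = ?s\<^sup>2 * ?c\<^sup>2 * ?d\<^sup>2" by (simp add: u1_def power_mult_distrib)
    show ?thesis
      unfolding c4 u1 u1'_def cn_squared dn_squared[OF assms] ab by algebra
  qed
  show ?thesis
    by (rule DERIV_cong[OF deriv]) (simp only: identity u2 distrib_left mult.left_commute)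
qed

lemma ell_modulus_facts:
  assumes "c < 0" "0 < a" "2 * c + a < 0" "- a - c < a"
  shows "(ell_modulus a c)\<^sup>2 = (2 * c + a) / (c - a)" "(ell_modulus a c)\<^sup>2 < 1"
proof -
  show *: "(ell_modulus a c)\<^sup>2 = (2 * c + a) / (c - a)"
    unfolding ell_modulus_def using assms by (subst real_sqrt_pow2) (auto simp: zero_le_divide_iff)
  show "(ell_modulus a c)\<^sup>2 < 1"
    unfolding * using assms by (simp add: divide_less_eq_1)
qed

text \<open>The substitution \<open>t \<mapsto> ell_arg a c y t\<close> multiplies the potential by \<open>(a - c) / 6\<close>, and
  \<open>(a - c) q\<^sup>2 = - (2 c + a)\<close> for the modulus \<open>q\<close> turns it into \<open>2 x\<^sub>0\<close>.\<close>

lemma rescaled_Lame_solution: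
  fixes u u' :: "real \<Rightarrow> real"
  assumes "c < 0" "0 < a" "2 * c + a < 0" "- a - c < a"
  defines "q \<equiv> ell_modulus a c" and "r \<equiv> sqrt ((a - c) / 6)"
  assumes u: "\<And>t. (u has_real_derivative u' t) (at t)"
    and u': "\<And>t. (u' has_real_derivative (12 * q\<^sup>2 * (sn t q)\<^sup>2 - 4 * (1 + q\<^sup>2)) * u t) (at t)"
  shows "((\<lambda>t. k * u (ell_arg a c y t)) has_real_derivative k * r * u' (ell_arg a c y t)) (at t)"
    and "((\<lambda>t. k * r * u' (ell_arg a c y t)) has_real_derivative
            2 * x0 a c y t * (k * u (ell_arg a c y t))) (at t)"
proof -
  have arg: "(ell_arg a c y has_real_derivative r) (at t)" for t
    unfolding ell_arg_def[abs_def] r_def by (auto intro!: derivative_eq_intros)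
  show "((\<lambda>t. k * u (ell_arg a c y t)) has_real_derivative k * r * u' (ell_arg a c y t)) (at t)"
    using DERIV_cmult[OF DERIV_chain2[OF u arg], of k] by (simp add: mult_ac)
  have r2: "r * r = (a - c) / 6"
    using assms by (simp add: r_def)
  have q2: "(a - c) * q\<^sup>2 = - (2 * c + a)"
    unfolding q_def ell_modulus_facts(1)[OF assms(1-4)] using assms by (simp add: field_simps)
  let ?S = "(sn (ell_arg a c y t) q)\<^sup>2"
  have "r * r * (12 * q\<^sup>2 * ?S - 4 * (1 + q\<^sup>2)) = 2 * x0 a c y t"
    unfolding r2 x0_def q_def[symmetric] using q2 by algebra
  then have "k * r * ((12 * q\<^sup>2 * ?S - 4 * (1 + q\<^sup>2)) * u (ell_arg a c y t) * r)
      = 2 * x0 a c y t * (k * u (ell_arg a c y t))"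
    by algebra
  then show "((\<lambda>t. k * r * u' (ell_arg a c y t)) has_real_derivative
            2 * x0 a c y t * (k * u (ell_arg a c y t))) (at t)"
    by (rule DERIV_cong[OF DERIV_cmult[OF DERIV_chain2[OF u' arg]]])
qed

section \<open>Variation of constants\<close>

lemma integral_deriv_within_halfline:
  fixes g :: "real \<Rightarrow> real"
  assumes "continuous_on {0..} g" "t \<ge> 0"
  shows "((\<lambda>t. integral {0..t} g) has_real_derivative g t) (at t within {0..})"
proof -
  have "((\<lambda>t. integral {0..t} g) has_real_derivative g t) (at t within {0..t + 1})"
    using assms by (intro integral_has_real_derivative) (auto intro: continuous_on_subset)
  moreover have "at t within {0..t + 1} = at t within {0..}"
    by (rule at_within_nhd[where S = "{..<t + 1}"]) auto
  ultimately show ?thesis by simp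
qed

locale normalized_fundamental_system =
  fixes v \<phi> \<psi> \<phi>' \<psi>' :: "real \<Rightarrow> real"
  assumes \<phi>: "\<And>t. t \<ge> 0 \<Longrightarrow> (\<phi> has_real_derivative \<phi>' t) (at t within {0..})"
    and \<psi>: "\<And>t. t \<ge> 0 \<Longrightarrow> (\<psi> has_real_derivative \<psi>' t) (at t within {0..})"
    and \<phi>': "\<And>t. t \<ge> 0 \<Longrightarrow> (\<phi>' has_real_derivative 2 * v t * \<phi> t) (at t within {0..})"
    and \<psi>': "\<And>t. t \<ge> 0 \<Longrightarrow> (\<psi>' has_real_derivative 2 * v t * \<psi> t) (at t within {0..})"
    and wronskian: "\<And>t. t \<ge> 0 \<Longrightarrow> \<phi> t * \<psi>' t - \<phi>' t * \<psi> t = 1"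
begin

definition solves :: "(real \<Rightarrow> real) \<Rightarrow> (real \<Rightarrow> real) \<Rightarrow> (real \<Rightarrow> real) \<Rightarrow> bool" where
  "solves f X \<Xi> \<longleftrightarrow> X 0 = 0 \<and> \<Xi> 0 = 0 \<and>
     (\<forall>t\<ge>0. (X has_real_derivative \<Xi> t) (at t within {0..})) \<and>
     (\<forall>t\<ge>0. (\<Xi> has_real_derivative 2 * v t * X t + f t) (at t within {0..}))"

text \<open>For a homogeneous solution \<open>\<theta>\<close> the terms with \<open>v\<close> cancel in the derivative of the
  Wronskian-type expression \<open>\<theta> \<Xi> - \<theta>' X\<close>, which leaves \<open>\<theta> f\<close>.\<close>

lemma has_integral_against_homogeneous_solution:
  assumes sol: "solves f X \<Xi>" and "t \<ge> 0"
    and \<theta>: "\<And>t. t \<ge> 0 \<Longrightarrow> (\<theta> has_real_derivative \<theta>' t) (at t within {0..})"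
    and \<theta>': "\<And>t. t \<ge> 0 \<Longrightarrow> (\<theta>' has_real_derivative 2 * v t * \<theta> t) (at t within {0..})"
  shows "((\<lambda>s. \<theta> s * f s) has_integral \<theta> t * \<Xi> t - \<theta>' t * X t) {0..t}"
proof -
  have "((\<lambda>s. \<theta> s * \<Xi> s - \<theta>' s * X s) has_real_derivative \<theta> s * f s) (at s within {0..t})"
    if "s \<in> {0..t}" for s
  proof (rule DERIV_subset[where s = "{0..}"])
    show "((\<lambda>s. \<theta> s * \<Xi> s - \<theta>' s * X s) has_real_derivative \<theta> s * f s) (at s within {0..})"
      using sol that unfolding solves_def
      by (auto intro!: derivative_eq_intros \<theta> \<theta>' simp: algebra_simps)
  qed auto
  then have "((\<lambda>s. \<theta> s * f s) has_integral
      (\<theta> t * \<Xi> t - \<theta>' t * X t) - (\<theta> 0 * \<Xi> 0 - \<theta>' 0 * X 0)) {0..t}"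
    by (intro fundamental_theorem_of_calculus \<open>t \<ge> 0\<close>)
       (auto simp: has_real_derivative_iff_has_vector_derivative[symmetric])
  with sol show ?thesis by (simp add: solves_def)
qed

text \<open>By Cramer's rule, with the Wronskian as determinant, \<open>\<phi> \<Xi> - \<phi>' X\<close> and \<open>\<psi> \<Xi> - \<psi>' X\<close> determine
  \<open>X\<close> and \<open>\<Xi>\<close>. As the right-hand sides depend only on \<open>f\<close>, the lemma contains uniqueness.\<close>

lemma solution_representation:
  assumes "solves f X \<Xi>" and "t \<ge> 0"
  shows "X t = \<psi> t * integral {0..t} (\<lambda>s. \<phi> s * f s) - \<phi> t * integral {0..t} (\<lambda>s. \<psi> s * f s)"
    and "\<Xi> t = \<psi>' t * integral {0..t} (\<lambda>s. \<phi> s * f s) - \<phi>' t * integral {0..t} (\<lambda>s. \<psi> s * f s)"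
    and "X t = integral {0..t} (\<lambda>s. volterra_kernel \<phi> \<psi> t s * f s)"
proof -
  note P = has_integral_against_homogeneous_solution[OF assms \<phi> \<phi>']
  note Q = has_integral_against_homogeneous_solution[OF assms \<psi> \<psi>']
  note W = wronskian[OF \<open>t \<ge> 0\<close>]
  have X': "X t = \<psi> t * (\<phi> t * \<Xi> t - \<phi>' t * X t) - \<phi> t * (\<psi> t * \<Xi> t - \<psi>' t * X t)"
    using W by algebra
  then show "X t = \<psi> t * integral {0..t} (\<lambda>s. \<phi> s * f s)
      - \<phi> t * integral {0..t} (\<lambda>s. \<psi> s * f s)"
    using P Q by (simp add: integral_unique)
  have "\<Xi> t = \<psi>' t * (\<phi> t * \<Xi> t - \<phi>' t * X t) - \<phi>' t * (\<psi> t * \<Xi> t - \<psi>' t * X t)"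
    using W by algebra
  then show "\<Xi> t = \<psi>' t * integral {0..t} (\<lambda>s. \<phi> s * f s)
      - \<phi>' t * integral {0..t} (\<lambda>s. \<psi> s * f s)"
    using P Q by (simp add: integral_unique)
  have "((\<lambda>s. \<psi> t * (\<phi> s * f s) - \<phi> t * (\<psi> s * f s)) has_integral X t) {0..t}"
    by (subst X') (intro has_integral_diff has_integral_mult_right P Q)
  then show "X t = integral {0..t} (\<lambda>s. volterra_kernel \<phi> \<psi> t s * f s)"
    by (simp add: volterra_kernel_def algebra_simps integral_unique)
qed

text \<open>Differentiating the integrals produces \<open>\<psi> \<phi> f - \<phi> \<psi> f = 0\<close> in the first component and
  \<open>\<psi>' \<phi> f - \<phi>' \<psi> f = f\<close> in the second.\<close>

lemma solution_exists:
  assumes f: "continuous_on {0..} f"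
  shows "solves f
    (\<lambda>t. \<psi> t * integral {0..t} (\<lambda>s. \<phi> s * f s) - \<phi> t * integral {0..t} (\<lambda>s. \<psi> s * f s))
    (\<lambda>t. \<psi>' t * integral {0..t} (\<lambda>s. \<phi> s * f s) - \<phi>' t * integral {0..t} (\<lambda>s. \<psi> s * f s))"
proof -
  have cont: "continuous_on {0..} \<phi>" "continuous_on {0..} \<psi>"
    using \<phi> \<psi> by (auto intro!: DERIV_continuous_on)
  have P: "((\<lambda>t. integral {0..t} (\<lambda>s. \<phi> s * f s)) has_real_derivative \<phi> t * f t)
      (at t within {0..})" if "t \<ge> 0" for t
    using cont f that by (intro integral_deriv_within_halfline continuous_intros)
  have Q: "((\<lambda>t. integral {0..t} (\<lambda>s. \<psi> s * f s)) has_real_derivative \<psi> t * f t)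
      (at t within {0..})" if "t \<ge> 0" for t
    using cont f that by (intro integral_deriv_within_halfline continuous_intros)
  have W: "\<psi>' t * (\<phi> t * f t) - \<phi>' t * (\<psi> t * f t) = f t" if "t \<ge> 0" for t
    using wronskian[OF that] by algebra
  show ?thesis
    unfolding solves_def
  proof (intro conjI allI impI)
    fix t :: real assume t: "t \<ge> 0"
    show "((\<lambda>t. \<psi> t * integral {0..t} (\<lambda>s. \<phi> s * f s) - \<phi> t * integral {0..t} (\<lambda>s. \<psi> s * f s))
        has_real_derivative
        \<psi>' t * integral {0..t} (\<lambda>s. \<phi> s * f s) - \<phi>' t * integral {0..t} (\<lambda>s. \<psi> s * f s))
        (at t within {0..})"
      by (rule DERIV_cong[OF DERIV_diff[OF DERIV_mult[OF \<psi>[OF t] P[OF t]]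
            DERIV_mult[OF \<phi>[OF t] Q[OF t]]]]) algebra
    show "((\<lambda>t. \<psi>' t * integral {0..t} (\<lambda>s. \<phi> s * f s) - \<phi>' t * integral {0..t} (\<lambda>s. \<psi> s * f s))
        has_real_derivative
        2 * v t * (\<psi> t * integral {0..t} (\<lambda>s. \<phi> s * f s) - \<phi> t * integral {0..t} (\<lambda>s. \<psi> s * f s))
          + f t) (at t within {0..})"
      by (rule DERIV_cong[OF DERIV_diff[OF DERIV_mult[OF \<psi>'[OF t] P[OF t]]
            DERIV_mult[OF \<phi>'[OF t] Q[OF t]]]]) (use W[OF t] in \<open>simp add: algebra_simps\<close>)
  qed auto
qed

end

section \<open>Adaptedness of pathwise integrals\<close>

text \<open>By uniform continuity, a subinterval of length \<open>h\<close> contributes an error of at most \<open>h e\<close> once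
  \<open>h\<close> is small; summing over the first \<open>m\<close> subintervals is an induction on \<open>m\<close>.\<close>

lemma Riemann_sums_tendsto_integral:
  fixes g :: "real \<Rightarrow> real"
  assumes g: "continuous_on {0..t} g" and "t \<ge> 0"
  shows "(\<lambda>n. \<Sum>i<Suc n. t / Suc n * g (t / Suc n * i)) \<longlonglongrightarrow> integral {0..t} g"
proof (rule LIMSEQ_I)
  fix r :: real assume "r > 0"
  \<comment> \<open>The summand \<open>1\<close> makes the choice valid for \<open>t = 0\<close> as well.\<close>
  define e where "e = r / (t + 1)"
  have "e > 0" "t * e < r" using \<open>r > 0\<close> \<open>t \<ge> 0\<close> by (auto simp: e_def field_simps)
  have "uniformly_continuous_on {0..t} g"
    using g by (intro compact_uniformly_continuous) auto
  then obtain d where "d > 0"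
    and d: "\<And>x y. x \<in> {0..t} \<Longrightarrow> y \<in> {0..t} \<Longrightarrow> \<bar>y - x\<bar> < d \<Longrightarrow> \<bar>g y - g x\<bar> < e"
    using \<open>e > 0\<close> unfolding uniformly_continuous_on_def dist_real_def by metis
  obtain N :: nat where N: "t / d < N" using reals_Archimedean2 by blast
  show "\<exists>n0. \<forall>n\<ge>n0. norm ((\<Sum>i<Suc n. t / Suc n * g (t / Suc n * i)) - integral {0..t} g) < r"
  proof (intro exI allI impI)
    fix n assume "n \<ge> N"
    define h where "h = t / Suc n"
    have "t < d * N" using N \<open>d > 0\<close> by (simp add: field_simps)
    also have "\<dots> \<le> d * Suc n" using \<open>n \<ge> N\<close> \<open>d > 0\<close> by (intro mult_left_mono) auto
    finally have h: "h \<ge> 0" "h < d" "h * Suc n = t"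
      using \<open>t \<ge> 0\<close> by (auto simp: h_def field_simps)
    have "\<bar>(\<Sum>i<m. h * g (h * i)) - integral {0..h * m} g\<bar> \<le> h * m * e" if "m \<le> Suc n" for m :: nat
      using that
    proof (induction m)
      case (Suc m)
      have le: "h * Suc m \<le> t" "h * m \<le> h * Suc m" "0 \<le> h * m"
        using Suc.prems h mult_left_mono[of "real (Suc m)" "real (Suc n)" h] by (auto simp: algebra_simps)
      have int: "g integrable_on {u..w}" if "0 \<le> u" "w \<le> t" for u w
        using that by (intro integrable_continuous_interval continuous_on_subset[OF g]) auto
      have "integral {h * m..h * Suc m} (\<lambda>s. g s - g (h * m))
          = integral {h * m..h * Suc m} g - h * g (h * m)"
      proof (subst integral_diff)
        show "g integrable_on {h * m..h * Suc m}" using le by (intro int)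
        have "h * Suc m - h * m = h" by (simp add: algebra_simps)
        then show "integral {h * m..h * Suc m} g - integral {h * m..h * Suc m} (\<lambda>s. g (h * m))
            = integral {h * m..h * Suc m} g - h * g (h * m)"
          using le(2) by simp
      qed (rule integrable_const_ivl)
      moreover have "norm (integral {h * m..h * Suc m} (\<lambda>s. g s - g (h * m)))
          \<le> e * (h * Suc m - h * m)"
      proof (rule integral_bound)
        show "h * m \<le> h * Suc m" by (rule le)
        show "continuous_on {h * m..h * Suc m} (\<lambda>s. g s - g (h * m))"
          using le by (intro continuous_intros continuous_on_subset[OF g]) auto
        fix s assume "s \<in> {h * m..h * Suc m}"
        then have "0 \<le> s" "s \<le> t" "\<bar>s - h * m\<bar> < d"
          using le h(2) unfolding of_nat_Suc distrib_left atLeastAtMost_iff by linarith+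
        then have "\<bar>g s - g (h * m)\<bar> < e"
          using le by (intro d) auto
        then show "norm (g s - g (h * m)) \<le> e" by simp
      qed
      moreover have "integral {0..h * m} g + integral {h * m..h * Suc m} g = integral {0..h * Suc m} g"
        by (rule Henstock_Kurzweil_Integration.integral_combine[OF le(3,2) int[OF order_refl le(1)]])
      moreover have "\<bar>(\<Sum>i<m. h * g (h * i)) - integral {0..h * m} g\<bar> \<le> h * m * e"
        using Suc by simp
      moreover have "e * (h * Suc m - h * m) = h * Suc m * e - h * m * e"
        by (simp add: algebra_simps)
      ultimately show ?case
        unfolding real_norm_def sum.lessThan_Suc by linarith
    qed simp
    from this[of "Suc n"] have "\<bar>(\<Sum>i<Suc n. h * g (h * i)) - integral {0..t} g\<bar> \<le> t * e"
      unfolding h(3) by simp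
    with \<open>t * e < r\<close> show "norm ((\<Sum>i<Suc n. t / Suc n * g (t / Suc n * i)) - integral {0..t} g) < r"
      by (simp add: h_def)
  qed
qed

text \<open>Preimages under \<open>X\<close> and \<open>Y\<close> differ by a subset of a null set of \<open>M\<close>. By completeness this subset
  is itself a null set of \<open>M\<close>, hence belongs to \<open>G\<close>.\<close>

lemma borel_measurable_AE_cong:
  fixes X Y :: "'w \<Rightarrow> real"
  assumes "complete_measure M" and space: "space G = space M" and null: "null_sets M \<subseteq> sets G"
    and Y: "Y \<in> borel_measurable G" and ae: "AE \<omega> in M. X \<omega> = Y \<omega>"
  shows "X \<in> borel_measurable G"
proof (rule measurableI)
  fix A :: "real set" assume A: "A \<in> sets borel"
  obtain N where N: "{\<omega> \<in> space M. X \<omega> \<noteq> Y \<omega>} \<subseteq> N" "N \<in> null_sets M"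
    using ae by (auto elim!: AE_E intro: null_setsI)
  have small: "S \<in> sets G" if "S \<subseteq> N" for S
  proof -
    have "S \<in> sets M" using complete_measure.complete[OF assms(1) that N(2)] .
    then have "S \<in> null_sets M" by (rule null_sets_subset[OF N(2) _ that])
    then show ?thesis using null by blast
  qed
  have off: "X \<omega> = Y \<omega>" if "\<omega> \<in> space M" "\<omega> \<notin> N" for \<omega>
    using N(1) that by blast
  have "X -` A \<inter> space G = (Y -` A \<inter> space G - N) \<union> (X -` A \<inter> space G \<inter> N)"
    unfolding space by (auto simp: off)
  also have "\<dots> \<in> sets G"
    by (rule sets.Un[OF sets.Diff[OF measurable_sets[OF Y A] small] small]) auto
  finally show "X -` A \<inter> space G \<in> sets G" .
qed simp

text \<open>The integral is almost surely the limit of Riemann sums, and these are measurable with respect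
  to the \<open>\<sigma>\<close>-algebra \<open>G\<close>; the exceptional null set is harmless because \<open>M\<close> is
  complete and \<open>G\<close> contains its null sets.\<close>

lemma integral_borel_measurable_null_augmented:
  fixes g :: "real \<Rightarrow> 'w \<Rightarrow> real"
  assumes "complete_measure M" "space G = space M" "null_sets M \<subseteq> sets G" and "t \<ge> 0"
    and g: "\<And>s. 0 \<le> s \<Longrightarrow> s \<le> t \<Longrightarrow> g s \<in> borel_measurable G"
    and cont: "AE \<omega> in M. continuous_on {0..t} (\<lambda>s. g s \<omega>)"
  shows "(\<lambda>\<omega>. integral {0..t} (\<lambda>s. g s \<omega>)) \<in> borel_measurable G"
proof -
  define R where "R n \<omega> = (\<Sum>i<Suc n. t / Suc n * g (t / Suc n * i) \<omega>)" for n \<omega>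
  have "R n \<in> borel_measurable G" for n
    unfolding R_def[abs_def]
  proof (intro borel_measurable_sum borel_measurable_times borel_measurable_const g)
    fix i assume i: "i \<in> {..<Suc n}"
    show "0 \<le> t / Suc n * i" using \<open>t \<ge> 0\<close> by simp
    have "t * (i / Suc n) \<le> t * 1"
      by (rule mult_left_mono[OF _ \<open>t \<ge> 0\<close>]) (use i in simp)
    then show "t / Suc n * i \<le> t" by simp
  qed
  then have "(\<lambda>\<omega>. lim (\<lambda>n. R n \<omega>)) \<in> borel_measurable G"
    by (rule borel_measurable_lim_metric)
  moreover have "AE \<omega> in M. integral {0..t} (\<lambda>s. g s \<omega>) = lim (\<lambda>n. R n \<omega>)"
    using cont
  proof eventually_elim
    case (elim \<omega>)
    show ?case
      unfolding R_def by (rule limI[symmetric, OF Riemann_sums_tendsto_integral[OF elim \<open>t \<ge> 0\<close>]])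
  qed
  ultimately show ?thesis
    by (rule borel_measurable_AE_cong[OF assms(1-3)])
qed

lemma
  fixes M :: "'w measure"
  shows space_brownian_filtration: "space (brownian_filtration M B t) = space M"
    and null_sets_brownian_filtration: "null_sets M \<subseteq> sets (brownian_filtration M B t)"
    and brownian_filtration_mono:
      "s \<le> t \<Longrightarrow> sets (brownian_filtration M B s) \<subseteq> sets (brownian_filtration M B t)"
proof -
  let ?\<C> = "\<lambda>t. {B s -` A \<inter> space M | s A. 0 \<le> s \<and> s \<le> t \<and> A \<in> sets borel} \<union> null_sets M"
  have sub: "?\<C> t \<subseteq> Pow (space M)" for t
    using sets.sets_into_space[of _ M] by (auto simp: null_sets_def)
  then have sets: "sets (brownian_filtration M B t) = sigma_sets (space M) (?\<C> t)" for t
    unfolding brownian_filtration_def by (rule sets_measure_of)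
  show "space (brownian_filtration M B t) = space M"
    unfolding brownian_filtration_def using sub by (rule space_measure_of)
  show "null_sets M \<subseteq> sets (brownian_filtration M B t)"
    unfolding sets by auto
  show "sets (brownian_filtration M B s) \<subseteq> sets (brownian_filtration M B t)" if "s \<le> t"
    unfolding sets
  proof (intro sigma_sets_mono' Un_mono subset_refl subsetI)
    fix S assume "S \<in> {B r -` A \<inter> space M | r A. 0 \<le> r \<and> r \<le> s \<and> A \<in> sets borel}"
    then obtain r A where "S = B r -` A \<inter> space M" "0 \<le> r" "r \<le> s" "A \<in> sets borel" by blast
    then show "S \<in> {B r -` A \<inter> space M | r A. 0 \<le> r \<and> r \<le> t \<and> A \<in> sets borel}"
      using that by (intro CollectI exI[of _ r] exI[of _ A]) auto
  qed
qed

lemma integral_adapted: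
  fixes g :: "real \<Rightarrow> 'w \<Rightarrow> real"
  assumes "complete_measure M" and g: "adapted (brownian_filtration M B) g"
    and cont: "AE \<omega> in M. continuous_on {0..} (\<lambda>s. g s \<omega>)"
  shows "adapted (brownian_filtration M B) (\<lambda>t \<omega>. integral {0..t} (\<lambda>s. g s \<omega>))"
  unfolding adapted_def
proof (intro allI impI)
  fix t :: real assume "t \<ge> 0"
  show "(\<lambda>\<omega>. integral {0..t} (\<lambda>s. g s \<omega>)) \<in> borel_measurable (brownian_filtration M B t)"
  proof (rule integral_borel_measurable_null_augmented[OF assms(1) space_brownian_filtration
        null_sets_brownian_filtration \<open>t \<ge> 0\<close>])
    fix s assume s: "0 \<le> s" "s \<le> t"
    have "g s \<in> borel_measurable (brownian_filtration M B s)"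
      using g s by (simp add: adapted_def)
    moreover have "subalgebra (brownian_filtration M B t) (brownian_filtration M B s)"
      using brownian_filtration_mono[OF s(2)] by (simp add: subalgebra_def space_brownian_filtration)
    ultimately show "g s \<in> borel_measurable (brownian_filtration M B t)"
      using measurable_from_subalg by blast
  next
    show "AE \<omega> in M. continuous_on {0..t} (\<lambda>s. g s \<omega>)"
      using cont by eventually_elim (auto intro: continuous_on_subset)
  qed
qed

section \<open>Strong solutions of the forced linear equation\<close>

lemma strong_solution_rode_imp_continuous:
  assumes "strong_solution_rode M B v f X \<Xi>"
  shows "AE \<omega> in M. continuous_on {0..} (\<lambda>t. X t \<omega>)"
proof -
  from assms have "AE \<omega> in M. X 0 \<omega> = 0 \<and> \<Xi> 0 \<omega> = 0 \<and>
      (\<forall>t\<ge>0. ((\<lambda>s. X s \<omega>) has_real_derivative \<Xi> t \<omega>) (at t within {0..})) \<and>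
      (\<forall>t\<ge>0. ((\<lambda>s. \<Xi> s \<omega>) has_real_derivative (2 * v t * X t \<omega> + f t \<omega>)) (at t within {0..}))"
    unfolding strong_solution_rode_def by (elim conjE)
  then show ?thesis
  proof eventually_elim
    case (elim \<omega>)
    then show ?case by (intro DERIV_continuous_on[where D = "\<lambda>t. \<Xi> t \<omega>"]) simp
  qed
qed

lemma strong_solution_sde_imp_continuous:
  assumes "strong_solution_sde M B v X \<Xi>"
  shows "AE \<omega> in M. continuous_on {0..} (\<lambda>t. X t \<omega>)"
proof -
  from assms have "AE \<omega> in M. continuous_on {0..} (\<lambda>t. X t \<omega>) \<and> continuous_on {0..} (\<lambda>t. \<Xi> t \<omega>) \<and>
      (\<forall>t\<ge>0. X t \<omega> = integral {0..t} (\<lambda>s. \<Xi> s \<omega>)) \<and>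
      (\<forall>t\<ge>0. \<Xi> t \<omega> = integral {0..t} (\<lambda>s. 2 * v s * X s \<omega>) + (B t \<omega> - B 0 \<omega>))"
    unfolding strong_solution_sde_def by (elim conjE)
  then show ?thesis
    by eventually_elim (elim conjE)
qed

lemma forcing_adapted_continuous:
  assumes adp: "\<And>m. 1 \<le> m \<Longrightarrow> m < n \<Longrightarrow> adapted F (x m)"
    and cont: "\<And>m. 1 \<le> m \<Longrightarrow> m < n \<Longrightarrow> AE \<omega> in M. continuous_on {0..} (\<lambda>t. x m t \<omega>)"
  shows "adapted F (forcing x n)"
    and "AE \<omega> in M. continuous_on {0..} (\<lambda>t. forcing x n t \<omega>)"
proof -
  show "adapted F (forcing x n)"
    unfolding adapted_def forcing_def[abs_def]
  proof (intro allI impI borel_measurable_sum borel_measurable_times)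
    fix t :: real and j assume "t \<ge> 0" "j \<in> {1..n-1}"
    then show "x j t \<in> borel_measurable (F t)" "x (n - j) t \<in> borel_measurable (F t)"
      using adp[of j] adp[of "n - j"] by (auto simp: adapted_def)
  qed
  have "AE \<omega> in M. \<forall>m\<in>{1..<n}. continuous_on {0..} (\<lambda>t. x m t \<omega>)"
    by (rule AE_ball_countable') (use cont in auto)
  then show "AE \<omega> in M. continuous_on {0..} (\<lambda>t. forcing x n t \<omega>)"
  proof eventually_elim
    case (elim \<omega>)
    show ?case
      unfolding forcing_def
    proof (intro continuous_on_sum continuous_on_mult)
      fix j assume "j \<in> {1..n-1}"
      then show "continuous_on {0..} (\<lambda>t. x j t \<omega>)" "continuous_on {0..} (\<lambda>t. x (n - j) t \<omega>)"
        using elim by auto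
    qed
  qed
qed

context normalized_fundamental_system
begin

lemma strong_solution_rode_iff:
  "strong_solution_rode M B v f X \<Xi> \<longleftrightarrow>
     adapted (brownian_filtration M B) X \<and> adapted (brownian_filtration M B) \<Xi> \<and>
     (AE \<omega> in M. solves (\<lambda>t. f t \<omega>) (\<lambda>t. X t \<omega>) (\<lambda>t. \<Xi> t \<omega>))"
  by (simp add: strong_solution_rode_def solves_def)

lemma strong_solution_rode_exists:
  assumes "complete_measure M" and f: "adapted (brownian_filtration M B) f"
    and cont: "AE \<omega> in M. continuous_on {0..} (\<lambda>t. f t \<omega>)"
  shows "\<exists>X \<Xi>. strong_solution_rode M B v f X \<Xi>"
proof -
  define P where "P t \<omega> = integral {0..t} (\<lambda>s. \<phi> s * f s \<omega>)" for t \<omega>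
  define Q where "Q t \<omega> = integral {0..t} (\<lambda>s. \<psi> s * f s \<omega>)" for t \<omega>
  have adapted_integral:
    "adapted (brownian_filtration M B) (\<lambda>t \<omega>. integral {0..t} (\<lambda>s. \<theta> s * f s \<omega>))"
    if \<theta>: "continuous_on {0..} \<theta>" for \<theta> :: "real \<Rightarrow> real"
  proof (rule integral_adapted[OF assms(1)])
    show "adapted (brownian_filtration M B) (\<lambda>s \<omega>. \<theta> s * f s \<omega>)"
      using f unfolding adapted_def
      by (intro allI impI borel_measurable_times borel_measurable_const) blast
    show "AE \<omega> in M. continuous_on {0..} (\<lambda>s. \<theta> s * f s \<omega>)"
      using cont by eventually_elim (intro continuous_on_mult \<theta>)
  qed
  have "adapted (brownian_filtration M B) P" "adapted (brownian_filtration M B) Q"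
    unfolding P_def[abs_def] Q_def[abs_def]
    using \<phi> \<psi> by (auto intro!: adapted_integral DERIV_continuous_on)
  then have "adapted (brownian_filtration M B) (\<lambda>t \<omega>. \<psi> t * P t \<omega> - \<phi> t * Q t \<omega>)"
    and "adapted (brownian_filtration M B) (\<lambda>t \<omega>. \<psi>' t * P t \<omega> - \<phi>' t * Q t \<omega>)"
    unfolding adapted_def
    by (intro allI impI borel_measurable_diff borel_measurable_times borel_measurable_const; blast)+
  moreover have "AE \<omega> in M. solves (\<lambda>t. f t \<omega>) (\<lambda>t. \<psi> t * P t \<omega> - \<phi> t * Q t \<omega>)
      (\<lambda>t. \<psi>' t * P t \<omega> - \<phi>' t * Q t \<omega>)"
    using cont unfolding P_def Q_def by eventually_elim (rule solution_exists)
  ultimately show ?thesis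
    unfolding strong_solution_rode_iff by blast
qed

lemma strong_solution_rode_representation:
  assumes "strong_solution_rode M B v f X \<Xi>"
  shows "AE \<omega> in M. \<forall>t\<ge>0.
      X t \<omega> = \<psi> t * integral {0..t} (\<lambda>s. \<phi> s * f s \<omega>) - \<phi> t * integral {0..t} (\<lambda>s. \<psi> s * f s \<omega>)
    \<and> X t \<omega> = integral {0..t} (\<lambda>s. volterra_kernel \<phi> \<psi> t s * f s \<omega>)"
proof -
  have "AE \<omega> in M. solves (\<lambda>t. f t \<omega>) (\<lambda>t. X t \<omega>) (\<lambda>t. \<Xi> t \<omega>)"
    using assms unfolding strong_solution_rode_iff by blast
  then show ?thesis
    by eventually_elim (intro allI impI conjI solution_representation)
qed

lemma strong_solution_rode_unique:
  assumes "strong_solution_rode M B v f X \<Xi>" "strong_solution_rode M B v f Y H"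
  shows "indistinguishable M X Y \<and> indistinguishable M \<Xi> H"
proof -
  have "AE \<omega> in M. solves (\<lambda>t. f t \<omega>) (\<lambda>t. X t \<omega>) (\<lambda>t. \<Xi> t \<omega>)"
    and "AE \<omega> in M. solves (\<lambda>t. f t \<omega>) (\<lambda>t. Y t \<omega>) (\<lambda>t. H t \<omega>)"
    using assms unfolding strong_solution_rode_iff by blast+
  then have *: "AE \<omega> in M. \<forall>t\<ge>0. X t \<omega> = Y t \<omega> \<and> \<Xi> t \<omega> = H t \<omega>"
  proof eventually_elim
    case (elim \<omega>)
    show ?case
      by (simp add: solution_representation(1,2)[OF elim(1)] solution_representation(1,2)[OF elim(2)])
  qed
  show ?thesis
    unfolding indistinguishable_def
  proof
    show "AE \<omega> in M. \<forall>t\<ge>0. X t \<omega> = Y t \<omega>" using * by eventually_elim simp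
    show "AE \<omega> in M. \<forall>t\<ge>0. \<Xi> t \<omega> = H t \<omega>" using * by eventually_elim simp
  qed
qed

end

theorem theorem2p4:
  fixes a c y \<kappa>1 \<kappa>2 :: real
    and M :: "'w measure" and B :: "real \<Rightarrow> 'w \<Rightarrow> real"
    and x \<xi> :: "nat \<Rightarrow> real \<Rightarrow> 'w \<Rightarrow> real"
    and n :: nat
  assumes "c < 0" "0 < a" "2 * c + a < 0" "c < - a - c" "- a - c < a"
    and "y \<in> {c..- a - c}"
    and "\<kappa>1 \<noteq> 0" "\<kappa>2 \<noteq> 0"
    and wronskian: "\<And>t. t \<ge> 0 \<Longrightarrow>
          w1 \<kappa>1 a c y t * deriv (w2 \<kappa>2 a c y) t - deriv (w1 \<kappa>1 a c y) t * w2 \<kappa>2 a c y t = 1"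
    and "prob_space M" "complete_measure M" "brownian_motion M B"
    and x1: "strong_solution_sde M B (x0 a c y) (x 1) (\<xi> 1)"
    and "n \<ge> 2"
    and previous: "\<And>m. 2 \<le> m \<Longrightarrow> m < n \<Longrightarrow>
          strong_solution_rode M B (x0 a c y) (forcing x m) (x m) (\<xi> m)"
  shows "(\<exists>X \<Xi>. strong_solution_rode M B (x0 a c y) (forcing x n) X \<Xi>) \<and>
    (\<forall>X \<Xi> Y H. strong_solution_rode M B (x0 a c y) (forcing x n) X \<Xi> \<and>
               strong_solution_rode M B (x0 a c y) (forcing x n) Y H \<longrightarrow>
               indistinguishable M X Y \<and> indistinguishable M \<Xi> H) \<and>
    (\<forall>X \<Xi>. strong_solution_rode M B (x0 a c y) (forcing x n) X \<Xi> \<longrightarrow>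
       (AE \<omega> in M. \<forall>t\<ge>0.
          X t \<omega> = w2 \<kappa>2 a c y t * integral {0..t} (\<lambda>s. w1 \<kappa>1 a c y s * forcing x n s \<omega>)
                - w1 \<kappa>1 a c y t * integral {0..t} (\<lambda>s. w2 \<kappa>2 a c y s * forcing x n s \<omega>)
        \<and> X t \<omega> = integral {0..t}
                (\<lambda>s. volterra_kernel (w1 \<kappa>1 a c y) (w2 \<kappa>2 a c y) t s * forcing x n s \<omega>)))"
proof -
  define q r where "q = ell_modulus a c" and "r = sqrt ((a - c) / 6)"
  define w1' where "w1' t = \<kappa>1 * r * u1' q (ell_arg a c y t)" for t
  define w2' where "w2' t = \<kappa>2 * r * u2' q (ell_arg a c y t)" for t
  note params = \<open>c < 0\<close> \<open>0 < a\<close> \<open>2 * c + a < 0\<close> \<open>- a - c < a\<close>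
  have q: "q\<^sup>2 < 1"
    unfolding q_def by (rule ell_modulus_facts[OF params])
  have w1: "w1 \<kappa>1 a c y = (\<lambda>t. \<kappa>1 * u1 q (ell_arg a c y t))"
    and w2: "w2 \<kappa>2 a c y = (\<lambda>t. \<kappa>2 * u2 q (ell_arg a c y t))"
    by (simp_all add: fun_eq_iff w1_def w2_def q_def)
  note Lame1 = rescaled_Lame_solution[OF params, folded q_def r_def, OF u1_deriv[OF q] u1'_deriv[OF q],
      of \<kappa>1 y, folded w1'_def]
  note Lame2 = rescaled_Lame_solution[OF params, folded q_def r_def, OF u2_deriv[OF q] u2'_deriv[OF q],
      of \<kappa>2 y, folded w2'_def]
  have w1_deriv: "(w1 \<kappa>1 a c y has_real_derivative w1' t) (at t)" for t
    unfolding w1 by (rule Lame1(1))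
  have w2_deriv: "(w2 \<kappa>2 a c y has_real_derivative w2' t) (at t)" for t
    unfolding w2 by (rule Lame2(1))
  have w1'_deriv: "(w1' has_real_derivative 2 * x0 a c y t * w1 \<kappa>1 a c y t) (at t)" for t
    unfolding w1 w1'_def[abs_def] by (rule Lame1(2)[unfolded w1'_def[abs_def]])
  have w2'_deriv: "(w2' has_real_derivative 2 * x0 a c y t * w2 \<kappa>2 a c y t) (at t)" for t
    unfolding w2 w2'_def[abs_def] by (rule Lame2(2)[unfolded w2'_def[abs_def]])
  interpret normalized_fundamental_system "x0 a c y" "w1 \<kappa>1 a c y" "w2 \<kappa>2 a c y" w1' w2'
  proof
    fix t :: real assume "t \<ge> 0"
    then show "w1 \<kappa>1 a c y t * w2' t - w1' t * w2 \<kappa>2 a c y t = 1"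
      using wronskian[of t] DERIV_imp_deriv[OF w1_deriv, of t] DERIV_imp_deriv[OF w2_deriv, of t]
      by simp
  qed (rule w1_deriv[THEN has_field_derivative_at_within] w2_deriv[THEN has_field_derivative_at_within]
        w1'_deriv[THEN has_field_derivative_at_within] w2'_deriv[THEN has_field_derivative_at_within])+
  have x: "adapted (brownian_filtration M B) (x m) \<and>
      (AE \<omega> in M. continuous_on {0..} (\<lambda>t. x m t \<omega>))" if "1 \<le> m" "m < n" for m
  proof (cases "m = 1")
    case True
    have "adapted (brownian_filtration M B) (x 1)"
      using x1 unfolding strong_solution_sde_def by (elim conjE)
    with strong_solution_sde_imp_continuous[OF x1] show ?thesis
      unfolding True by (rule conjI[rotated])
  next
    case False
    with that have sol: "strong_solution_rode M B (x0 a c y) (forcing x m) (x m) (\<xi> m)"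
      by (intro previous) auto
    then have "adapted (brownian_filtration M B) (x m)"
      unfolding strong_solution_rode_def by (elim conjE)
    with strong_solution_rode_imp_continuous[OF sol] show ?thesis by (rule conjI[rotated])
  qed
  have f: "adapted (brownian_filtration M B) (forcing x n)"
    "AE \<omega> in M. continuous_on {0..} (\<lambda>t. forcing x n t \<omega>)"
    by (rule forcing_adapted_continuous; use x in blast)+
  show ?thesis
  proof (intro conjI allI impI)
    show "\<exists>X \<Xi>. strong_solution_rode M B (x0 a c y) (forcing x n) X \<Xi>"
      by (rule strong_solution_rode_exists[OF \<open>complete_measure M\<close> f])
  next
    fix X \<Xi> Y H
    assume "strong_solution_rode M B (x0 a c y) (forcing x n) X \<Xi> \<and>
      strong_solution_rode M B (x0 a c y) (forcing x n) Y H"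
    then show "indistinguishable M X Y" "indistinguishable M \<Xi> H"
      using strong_solution_rode_unique by blast+
  qed (rule strong_solution_rode_representation)
qed

end
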